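(* Let $n\ge 1$ be the number of observations, and let $n_A,n_T\in\{0,1,\dots,n\}$ denote the number of treated units (entries equal to $1$ in the AFFECTED vector) and the number of post-treatment observations (entries equal to $1$ in the TIME vector), respectively. When margins are randomised while preserving their empirical counts, the number of admissible label assignments is $$\#\Omega(\text{AFFECTED only})=\binom{n}{n_A},\qquad \#\Omega(\text{AFFECTED \& TIME})=\binom{n}{n_A}\binom{n}{n_T},$$ so that the multiplicative gain from dual randomization, i.e. the ratio $\#\Omega(\text{AFFECTED \& TIME})/\#\Omega(\text{AFFECTED only})$, equals $\binom{n}{n_T}$. Under unconstrained Bernoulli($1/2$) reshuffling, the corresponding gain is $2^n$.
   Context: The sample carries two binary label vectors of length $n$: AFFECTED $\in\{0,1\}^n$ (treated or control) and TIME $\in\{0,1\}^n$ (post- or pre-treatment). Randomization preserving empirical counts (fixed margins): $\Omega(\text{AFFECTED only})$ is the set of all vectors $a\in\{0,1\}^n$ with exactly $n_A$ ones, with TIME kept fixed. $\Omega(\text{AFFECTED \& TIME})$ is the set of all pairs $(a,t)\in\{0,1\}^n\times\{0,1\}^n$ such that $a$ has exactly $n_A$ ones and $t$ has exactly $n_T$ ones. Unconstrained Bernoulli($1/2$) reshuffling: each entry of a randomised label vector is drawn independently from $\{0,1\}$ with probability $1/2$ each, with no constraint on the number of ones. The set of possible assignments is then $\{0,1\}^n$ when only AFFECTED is randomised, and $\{0,1\}^n\times\{0,1\}^n$ when both AFFECTED and TIME are randomised. The gain is again the ratio of the cardinality of the second set to that of the first. *)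

theory Defs
  imports "HOL-Probability.Probability"
begin

text \<open>A label vector in \<open>{0,1}\<^sup>n\<close> is a list of length \<open>n\<close> with entries in \<open>{0, 1}\<close>.\<close>

definition label_vectors :: "nat \<Rightarrow> nat list set" where
  "label_vectors n = {x. length x = n \<and> set x \<subseteq> {0, 1}}"

definition num_ones :: "nat list \<Rightarrow> nat" where
  "num_ones x = count_list x 1"

text \<open>As TIME is kept fixed here, an assignment is determined by its AFFECTED component.\<close>

definition Omega_affected :: "nat \<Rightarrow> nat \<Rightarrow> nat list set" where
  "Omega_affected n nA = {a \<in> label_vectors n. num_ones a = nA}"

definition Omega_affected_time :: "nat \<Rightarrow> nat \<Rightarrow> nat \<Rightarrow> (nat list \<times> nat list) set" where
  "Omega_affected_time n nA nT =
     {(a, t). a \<in> label_vectors n \<and> t \<in> label_vectors n \<and> num_ones a = nA \<and> num_ones t = nT}"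

definition bernoulli_labels :: "nat \<Rightarrow> nat list pmf" where
  "bernoulli_labels n = replicate_pmf n (map_pmf of_bool (bernoulli_pmf (1/2)))"

text \<open>The possible assignments under Bernoulli reshuffling are those drawn with positive
  probability; by the two lemmas below they are all of \<open>{0,1}\<^sup>n\<close> and of
  \<open>{0,1}\<^sup>n \<times> {0,1}\<^sup>n\<close>, respectively.\<close>

definition Bernoulli_affected :: "nat \<Rightarrow> nat list set" where
  "Bernoulli_affected n = set_pmf (bernoulli_labels n)"

definition Bernoulli_affected_time :: "nat \<Rightarrow> (nat list \<times> nat list) set" where
  "Bernoulli_affected_time n = set_pmf (pair_pmf (bernoulli_labels n) (bernoulli_labels n))"

lemma Bernoulli_affected_eq: "Bernoulli_affected n = label_vectors n"
proof -
  have 1: "set_pmf (map_pmf of_bool (bernoulli_pmf (1/2))) = {0, 1 :: nat}"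
    unfolding set_map_pmf by (subst set_pmf_bernoulli) (simp_all add: UNIV_bool insert_commute)
  show ?thesis
    unfolding Bernoulli_affected_def bernoulli_labels_def label_vectors_def set_replicate_pmf 1
      lists_eq_set
    by blast
qed

lemma Bernoulli_affected_time_eq:
  "Bernoulli_affected_time n = label_vectors n \<times> label_vectors n"
  using Bernoulli_affected_eq[of n]
  by (simp add: Bernoulli_affected_time_def Bernoulli_affected_def)

text \<open>Multiplicative gain in passing from the assignments \<open>S\<close> to the assignments \<open>D\<close>.\<close>

definition gain :: "'a set \<Rightarrow> 'b set \<Rightarrow> real" where
  "gain S D = real (card D) / real (card S)"

end

theory Submission
  imports Defs
begin

text \<open>Splitting fixed-margin vectors on their first entry gives the recurrence of the binomial
  coefficients (\<open>card_Omega_affected\<close>). When both labels are randomised, the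
  constraints on the two components are independent, so the assignments form a Cartesian product
  whose first factor is the AFFECTED-only set. The gain is therefore the size of the TIME factor
  (\<open>gain_Times\<close>): a binomial coefficient for fixed margins, 2^n for Bernoulli
  labels.\<close>

lemma card_label_vectors: "card (label_vectors n) = 2 ^ n"
proof -
  have "label_vectors n = {x. set x \<subseteq> {0, 1} \<and> length x = n}"
    unfolding label_vectors_def by blast
  then show ?thesis by (simp add: card_lists_length_eq numeral_2_eq_2)
qed

lemma finite_label_vectors: "finite (label_vectors n)"
  \<comment> \<open>An infinite set has \<open>card\<close> equal to 0, so the positive value
    \<open>2 ^ n\<close> already forces finiteness.\<close>
  by (rule card_ge_0_finite) (simp add: card_label_vectors)

lemma finite_Omega_affected: "finite (Omega_affected n k)"
  unfolding Omega_affected_def by (simp add: finite_label_vectors)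

lemma Omega_affected_0: "Omega_affected 0 k = (if k = 0 then {[]} else {})"
  unfolding Omega_affected_def label_vectors_def num_ones_def by auto

lemma Omega_affected_Suc_0: "Omega_affected (Suc n) 0 = Cons 0 ` Omega_affected n 0"
  unfolding Omega_affected_def label_vectors_def num_ones_def
  by (auto simp: length_Suc_conv)

text \<open>A leading 0 leaves all the ones to the tail, a leading 1 uses up one of them. The two
  images are disjoint, so on cardinalities this is Pascal's rule.\<close>

lemma Omega_affected_Suc_Suc:
  "Omega_affected (Suc n) (Suc k) =
     Cons 0 ` Omega_affected n (Suc k) \<union> Cons 1 ` Omega_affected n k"
  unfolding Omega_affected_def label_vectors_def num_ones_def
  by (auto simp: length_Suc_conv)

lemma card_Omega_affected: "card (Omega_affected n k) = n choose k"
proof (induction n arbitrary: k)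
  case 0
  then show ?case by (cases k) (simp_all add: Omega_affected_0)
next
  case (Suc n)
  then show ?case
  proof (cases k)
    case 0
    then show ?thesis by (simp add: Suc.IH Omega_affected_Suc_0 card_image)
  next
    case (Suc j)
    have "card (Omega_affected (Suc n) (Suc j)) =
        card (Cons 0 ` Omega_affected n (Suc j)) + card (Cons 1 ` Omega_affected n j)"
      unfolding Omega_affected_Suc_Suc
      by (intro card_Un_disjoint) (auto simp: finite_Omega_affected)
    with Suc show ?thesis by (simp add: Suc.IH card_image)
  qed
qed

lemma Omega_affected_time_eq:
  "Omega_affected_time n k l = Omega_affected n k \<times> Omega_affected n l"
  unfolding Omega_affected_time_def Omega_affected_def by auto

text \<open>Positivity lets \<open>card A\<close> cancel; at \<open>card A = 0\<close> the quotient
  would be 0 by convention.\<close>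

lemma gain_Times:
  assumes "card A > 0"
  shows "gain A (A \<times> B) = real (card B)"
  using assms by (simp add: gain_def card_cartesian_product)

theorem proposition1:
  fixes n nA nT :: nat
  assumes "n \<ge> 1" and "nA \<in> {0..n}" and "nT \<in> {0..n}"
  shows "card (Omega_affected n nA) = n choose nA
       \<and> card (Omega_affected_time n nA nT) = (n choose nA) * (n choose nT)
       \<and> gain (Omega_affected n nA) (Omega_affected_time n nA nT) = real (n choose nT)
       \<and> gain (Bernoulli_affected n) (Bernoulli_affected_time n) = 2 ^ n"
  \<comment> \<open>The bound \<open>nA \<le> n\<close> makes \<open>n choose nA\<close> positive,
    as the cancellation in \<open>gain_Times\<close> requires.\<close>
  using assms(2)
  by (simp add: card_Omega_affected Omega_affected_time_eq card_cartesian_product gain_Times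
      Bernoulli_affected_eq Bernoulli_affected_time_eq card_label_vectors)

end
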